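(* Let $n>1$ be an integer, let $J,K,L,M\in\mathbb{R}^n$ satisfy $|JK|<|LM|$, and put $\varepsilon=\frac{|LM|-|JK|}{3}$. Then there exist an $\varepsilon$-set $T_{JK}(\varepsilon)\subseteq\mathbb{R}^n$ for the pair $(J,K)$ and an $\varepsilon$-set $T_{LM}(\varepsilon)\subseteq\mathbb{R}^n$ for the pair $(L,M)$, and for any such sets, every map $f:T_{JK}(\varepsilon)\cup T_{LM}(\varepsilon)\to\mathbb{R}^n$ that preserves unit distance satisfies $|f(J)f(K)|<|f(L)f(M)|$.
   Context: For points $P,Q\in\mathbb{R}^n$, $|PQ|=|P-Q|$ is their Euclidean distance. A map $f:S\to\mathbb{R}^n$ with $S\subseteq\mathbb{R}^n$ preserves unit distance if for all $u,v\in S$, $|u-v|=1$ implies $|f(u)-f(v)|=1$. Maps are arbitrary functions (no continuity or injectivity is assumed). For $x,y\in\mathbb{R}^n$ and $\varepsilon>0$, an $\varepsilon$-set for the pair $(x,y)$ is a finite set $T\subseteq\mathbb{R}^n$ containing $x$ and $y$ such that every map $g:T\to\mathbb{R}^n$ preserving unit distance satisfies $\big||g(x)-g(y)|-|x-y|\big|\le\varepsilon$. *)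

theory Defs
  imports "HOL-Analysis.Analysis"
begin

(* A map S -> R^n is represented by a total function of which only the values on S are used. *)

definition preserves_unit_distance_on ::
    "(real ^ 'n) set \<Rightarrow> (real ^ 'n \<Rightarrow> real ^ 'n) \<Rightarrow> bool" where
  "preserves_unit_distance_on S f \<longleftrightarrow>
     (\<forall>u\<in>S. \<forall>v\<in>S. dist u v = 1 \<longrightarrow> dist (f u) (f v) = 1)"

definition eps_set :: "real \<Rightarrow> real ^ 'n \<Rightarrow> real ^ 'n \<Rightarrow> (real ^ 'n) set \<Rightarrow> bool" where
  "eps_set \<epsilon> x y T \<longleftrightarrow>
     finite T \<and> x \<in> T \<and> y \<in> T \<and>
     (\<forall>g. preserves_unit_distance_on T g \<longrightarrow> \<bar>dist (g x) (g y) - dist x y\<bar> \<le> \<epsilon>)"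

end

theory Submission
  imports Defs
begin

text \<open>A map preserving the unit distance sends a bipyramid over a simplex of \<open>n\<close> points, all of whose
  edges have preserved lengths, to a congruent bipyramid or to one with coinciding apexes. Coinciding
  apexes can be excluded by adding a further point, so that the distance of the apexes is preserved as
  well. In this way one finds a preserved distance larger than 1 and one smaller than 1; by scaling,
  all their powers are preserved. Chains of short steps make the map nonexpansive, and long distances
  then force it to be an isometry (Beckman-Quarles). A compactness argument turns this into
  the existence of finite \<open>\<epsilon>\<close>-sets, after which the comparison of the two distances is the triangle
  inequality.\<close>

section \<open>Preserved distances and the existence of triangles\<close>

definition preserves_distance :: "('a::metric_space \<Rightarrow> 'b::metric_space) \<Rightarrow> real \<Rightarrow> bool" where
  "preserves_distance f d \<longleftrightarrow> (\<forall>u v. dist u v = d \<longrightarrow> dist (f u) (f v) = d)"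

lemma preserves_distanceD:
  "preserves_distance f d \<Longrightarrow> dist u v = d \<Longrightarrow> dist (f u) (f v) = d"
  by (simp add: preserves_distance_def)

text \<open>The law of cosines places the foot of the altitude from \<open>z\<close> on the line
  through \<open>x\<close> and \<open>y\<close>; a second dimension provides the direction of the
  altitude. Degenerate triangles are included, also with \<open>x = y\<close>.\<close>

lemma exists_triangle:
  fixes x y :: "'a::euclidean_space"
  assumes dim: "2 \<le> DIM('a)"
    and tri: "dist x y \<le> a + b" "a \<le> dist x y + b" "b \<le> dist x y + a"
  obtains z where "dist x z = a" "dist y z = b"
proof -
  define c where "c = dist x y"
  have a0: "a \<ge> 0" "b \<ge> 0" using tri zero_le_dist[of x y] by linarith+
  \<comment> \<open>For \<open>x = y\<close> division by zero makes \<open>e\<close> the zero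
    vector, which still has a nonzero orthogonal vector.\<close>
  define e where "e = (y - x) /\<^sub>R c"
  have ye: "y - x = c *\<^sub>R e" "c \<noteq> 0 \<Longrightarrow> norm e = 1" "c = 0 \<Longrightarrow> e = 0"
    by (cases "x = y"; simp add: e_def c_def dist_norm norm_minus_commute)+
  obtain w' :: 'a where w': "w' \<noteq> 0" "orthogonal e w'"
    using orthogonal_to_vector_exists[OF dim] by blast
  define w where "w = w' /\<^sub>R norm w'"
  have w: "w \<bullet> w = 1" "e \<bullet> w = 0"
    using w' by (auto simp: w_def orthogonal_def norm_eq_sqrt_inner field_simps)
  show ?thesis
  proof (cases "c = 0")
    case True
    then have "x = y" "a = b" using tri by (auto simp: c_def)
    moreover have "dist x (x + a *\<^sub>R w) = a" using w a0 by (simp add: dist_norm norm_eq_sqrt_inner)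
    ultimately show ?thesis using that by blast
  next
    case False
    then have c: "c > 0" by (simp add: c_def)
    \<comment> \<open>\<open>s\<close> is the signed distance of the foot from \<open>x\<close>, and
      \<open>t\<close> below is the altitude. The triangle inequalities are what makes
      \<open>a\<^sup>2 - s\<^sup>2\<close> nonnegative.\<close>
    define s where "s = (a\<^sup>2 + c\<^sup>2 - b\<^sup>2) / (2 * c)"
    have sc: "2 * c * s = a\<^sup>2 + c\<^sup>2 - b\<^sup>2" using c by (simp add: s_def)
    have "2 * c * s \<le> 2 * c * a" 
    proof -
      have "(c - a)\<^sup>2 \<le> b\<^sup>2" using tri by (intro abs_le_square_iff[THEN iffD1]) (auto simp: c_def)
      then show ?thesis unfolding sc by (simp add: power2_eq_square algebra_simps)
    qed
    moreover have "2 * c * (-a) \<le> 2 * c * s" 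
    proof -
      have "b\<^sup>2 \<le> (c + a)\<^sup>2" using tri a0 by (intro power_mono) (auto simp: c_def)
      then show ?thesis unfolding sc by (simp add: power2_eq_square algebra_simps)
    qed
    ultimately have "s \<le> a" "- a \<le> s"
      using c by (auto intro: mult_left_le_imp_le[of "2 * c"])
    then have "\<bar>s\<bar> \<le> \<bar>a\<bar>" by simp
    then have sa: "s\<^sup>2 \<le> a\<^sup>2" by (simp add: abs_le_square_iff)
    define t where "t = sqrt (a\<^sup>2 - s\<^sup>2)"
    have t: "t\<^sup>2 = a\<^sup>2 - s\<^sup>2" using sa by (simp add: t_def)
    have ee: "e \<bullet> e = 1" using ye(2) False by (simp add: norm_eq_1)
    define z where "z = x + s *\<^sub>R e + t *\<^sub>R w"
    have norm_ew: "norm (p *\<^sub>R e + q *\<^sub>R w) = sqrt (p\<^sup>2 + q\<^sup>2)" for p q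
      using w ee by (simp add: norm_eq_sqrt_inner inner_add_left inner_add_right inner_commute power2_eq_square)
    have "z - x = s *\<^sub>R e + t *\<^sub>R w" "z - y = (s - c) *\<^sub>R e + t *\<^sub>R w"
      using ye(1) by (auto simp: z_def algebra_simps)
    then have "dist z x = sqrt (s\<^sup>2 + t\<^sup>2)" "dist z y = sqrt ((s - c)\<^sup>2 + t\<^sup>2)"
      by (auto simp: dist_norm norm_ew)
    moreover have "(s - c)\<^sup>2 + t\<^sup>2 = b\<^sup>2" using t sc by (simp add: power2_eq_square algebra_simps)
    ultimately show ?thesis using that[of z] t a0 by (simp add: dist_commute)
  qed
qed

section \<open>Bipyramids over simplices\<close>

text \<open>The Gram matrix of a basis determines the unique vector having inner product 1/2 with
  all its members up to an orthogonal map; here that vector is \<open>u /\<^sub>R (norm u)\<^sup>2\<close>.\<close>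

lemma Gram_determines_norm:
  fixes b b' :: "'n::finite \<Rightarrow> real ^ 'n"
  assumes gram: "\<And>i j. b i \<bullet> b j = b' i \<bullet> b' j"
    and basis: "\<And>x. (\<And>i. b i \<bullet> x = 0) \<Longrightarrow> x = 0"
    and u: "\<And>i. 2 * (b i \<bullet> u) = (norm u)\<^sup>2" "u \<noteq> 0"
    and u': "\<And>i. 2 * (b' i \<bullet> u') = (norm u')\<^sup>2" "u' \<noteq> 0"
  shows "norm u' = norm u"
proof -
  define B where "B = (\<chi> i. b i)"
  define B' where "B' = (\<chi> i. b' i)"
  have Bv: "B *v x = (\<chi> i. b i \<bullet> x)" "B' *v x = (\<chi> i. b' i \<bullet> x)" for x
    by (simp_all add: B_def B'_def matrix_vector_mult_def inner_vec_def)
  have G: "B ** transpose B = B' ** transpose B'"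
    using gram by (simp add: B_def B'_def matrix_matrix_mult_def transpose_def inner_vec_def vec_eq_iff)
  have "\<exists>C. C ** B = mat 1"
    unfolding matrix_left_invertible_ker Bv using basis by (auto simp: vec_eq_iff)
  then have "invertible B" by (simp add: invertible_left_inverse)
  then have "det (B ** transpose B) \<noteq> 0" by (simp add: det_mul invertible_det_nz)
  then have "det B' \<noteq> 0" by (auto simp: G det_mul)
  then obtain C where C: "C ** B' = mat 1"
    by (metis invertible_det_nz invertible_left_inverse)
  \<comment> \<open>\<open>C\<close> inverts \<open>B'\<close>, so equality of the two Gram matrices
    turns into orthogonality of \<open>A\<close>.\<close>
  define A where "A = C ** B"
  have "A ** transpose A = C ** (B ** transpose B) ** transpose C"
    by (simp add: A_def matrix_transpose_mul matrix_mul_assoc)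
  also have "\<dots> = (C ** B') ** transpose (C ** B')"
    by (simp add: G matrix_transpose_mul matrix_mul_assoc)
  finally have "A ** transpose A = mat 1" by (simp add: C)
  then have orth: "orthogonal_transformation ((*v) A)"
    by (simp add: orthogonal_transformation_matrix orthogonal_matrix matrix_left_right_inverse)
  define q where "q = u /\<^sub>R (norm u)\<^sup>2"
  define q' where "q' = u' /\<^sub>R (norm u')\<^sup>2"
  have "B *v q = (\<chi> i. 1/2)" "B' *v q' = (\<chi> i. 1/2)"
    unfolding Bv q_def q'_def using u u' by (simp_all add: vec_eq_iff field_simps)
  then have "A *v q = q'"
    by (metis A_def C matrix_vector_mul_assoc matrix_vector_mul_lid)
  then have "norm q' = norm q" using orth orthogonal_transformation_norm by metis
  moreover have "norm q = inverse (norm u)" "norm q' = inverse (norm u')"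
    using u u' by (simp_all add: q_def q'_def power2_eq_square field_simps)
  ultimately show ?thesis by simp
qed

text \<open>The model has apexes 0 and \<open>u\<close> and facet points \<open>b i\<close>; the
  condition on \<open>u\<close> says that each \<open>b i\<close> is equidistant from both apexes.
  In a copy with apexes \<open>x\<close> and \<open>y\<close> all edges keep their lengths under
  \<open>f\<close>, so the facet points seen from \<open>f x\<close> have the same Gram matrix as
  before. This fixes the distance of the image apexes unless they coincide.\<close>

lemma bipyramid_axis:
  fixes f :: "real ^ 'n \<Rightarrow> real ^ 'n" and b :: "'n \<Rightarrow> real ^ 'n"
  assumes side: "\<And>i. preserves_distance f (norm (b i))"
    and facet: "\<And>i j. i \<noteq> j \<Longrightarrow> preserves_distance f (dist (b i) (b j))"
    and basis: "\<And>x. (\<And>i. b i \<bullet> x = 0) \<Longrightarrow> x = 0"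
    and u: "\<And>i. 2 * (b i \<bullet> u) = (norm u)\<^sup>2" "u \<noteq> 0"
    and xy: "dist x y = norm u"
  shows "f x = f y \<or> dist (f x) (f y) = norm u"
proof (cases "f x = f y")
  case False
  obtain T where T: "orthogonal_transformation T" "T u = y - x"
    using orthogonal_transformation_exists[of u "y - x"] xy
    by (metis dist_norm norm_minus_commute)
  have lin: "linear T" using T by (simp add: orthogonal_transformation_def)
  define v where "v i = x + T (b i)" for i
  define b' where "b' i = f (v i) - f x" for i
  have Td: "dist (T p) (T q) = dist p q" for p q
    using T(1) by (simp add: dist_norm orthogonal_transformation_norm flip: linear_diff[OF lin])
  have bu: "norm (b i - u) = norm (b i)" for i
    using u(1)[of i] by (simp add: norm_eq_sqrt_inner power2_norm_eq_inner inner_diff inner_commute)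
  have vx: "dist (v i) x = norm (b i)" for i
    using T(1) by (simp add: v_def dist_norm orthogonal_transformation_norm)
  have vy: "dist (v i) y = norm (b i)" for i
  proof -
    have "v i - y = T (b i - u)" using T(2) by (simp add: v_def linear_diff[OF lin])
    then show ?thesis using T(1) bu by (simp add: dist_norm orthogonal_transformation_norm)
  qed
  have vv: "dist (v i) (v j) = dist (b i) (b j)" for i j
    by (simp add: v_def Td)
  have nb: "norm (b' i) = norm (b i)" for i
    using preserves_distanceD[OF side vx] by (simp add: b'_def dist_norm)
  have ny: "norm (b' i - (f y - f x)) = norm (b i)" for i
    using preserves_distanceD[OF side vy] by (simp add: b'_def dist_norm)
  have nbb: "norm (b' i - b' j) = norm (b i - b j)" for i j
    using preserves_distanceD[OF facet vv, of i j] by (cases "i = j") (auto simp: b'_def dist_norm)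
  have "norm (f y - f x) = norm u"
  proof (rule Gram_determines_norm[OF _ basis u])
    show "b i \<bullet> b j = b' i \<bullet> b' j" for i j
      using nb[of i] nb[of j] nbb[of i j] by (simp add: dot_norm_neg)
    show "2 * (b' i \<bullet> (f y - f x)) = (norm (f y - f x))\<^sup>2" for i
      using nb[of i] ny[of i] by (simp add: dot_norm_neg)
  qed (use False in auto)
  then show ?thesis by (simp add: dist_norm norm_minus_commute)
qed auto

text \<open>The facet, a regular simplex with n vertices and edge \<open>a\<close>, has squared
  circumradius a^2 (n - 1) / (2 n). With lateral edge \<open>b\<close>, Pythagoras gives the height,
  and \<open>t\<close> is twice the height.\<close>

lemma regular_bipyramid:
  fixes f :: "real ^ 'n \<Rightarrow> real ^ 'n"
  defines "n \<equiv> real CARD('n)"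
  assumes a: "preserves_distance f a" "a > 0" and b: "preserves_distance f b" "b > 0"
    and t: "t\<^sup>2 = 4 * b\<^sup>2 - 2 * a\<^sup>2 * (n - 1) / n" "t > 0" and xy: "dist x y = t"
  shows "f x = f y \<or> dist (f x) (f y) = t"
proof -
  have n: "n > 0" by (simp add: n_def)
  \<comment> \<open>The points \<open>axis i s\<close> have mutual distance \<open>a\<close>. The
    shift by \<open>k\<close> along the diagonal raises their coordinate sum to \<open>h\<close>,
    which puts the facet at distance \<open>t / 2\<close> from the origin.\<close>
  define s where "s = a / sqrt 2"
  define h where "h = t * sqrt n / 2"
  define k where "k = (h - s) / n"
  define one :: "real ^ 'n" where "one = vec 1"
  define u where "u = (t / sqrt n) *\<^sub>R one"
  define e where "e i = axis i s + k *\<^sub>R one" for i :: 'n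
  have one: "one \<bullet> y = (\<Sum>i\<in>UNIV. y $ i)" "y \<bullet> one = (\<Sum>i\<in>UNIV. y $ i)" for y
    by (simp_all add: one_def inner_vec_def)
  have one_i: "one $ i = 1" for i by (simp add: one_def)
  have n1: "(\<Sum>i\<in>(UNIV::'n set). one $ i) = n" by (simp add: one_i n_def)
  have s2: "s\<^sup>2 = a\<^sup>2 / 2" and s0: "s > 0" using a by (simp_all add: s_def power_divide)
  have nk: "n * k = h - s" using n by (simp add: k_def)
  have h2: "h\<^sup>2 = t\<^sup>2 * n / 4" and h0: "h > 0"
    using n t by (simp_all add: h_def power_divide power_mult_distrib)
  have ax: "(\<Sum>j\<in>UNIV. axis i s $ j) = s" for i :: 'n by (simp add: axis_def)
  have ee: "e i \<bullet> e j = (if i = j then s\<^sup>2 else 0) + 2 * s * k + n * k\<^sup>2" for i j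
    by (simp add: e_def inner_add_left inner_add_right one sum.distrib one_i n_def ax inner_axis_axis
        power2_eq_square algebra_simps)
  have nu: "norm u = t"
    using t n by (simp add: u_def norm_eq_sqrt_inner[of one] one n1)
  have "n * (e i \<bullet> e i) = n * b\<^sup>2" for i
  proof -
    have "n * (e i \<bullet> e i) = n * s\<^sup>2 + 2 * s * (n * k) + (n * k)\<^sup>2"
      by (simp add: ee power2_eq_square algebra_simps)
    also have "\<dots> = (n - 1) * s\<^sup>2 + h\<^sup>2"
      unfolding nk by (simp add: power2_eq_square algebra_simps)
    also have "\<dots> = n * b\<^sup>2" using t(1) n by (simp add: s2 h2 field_simps)
    finally show ?thesis .
  qed
  then have eb: "norm (e i) = b" for i using n b by (simp add: norm_eq_sqrt_inner)
  have eij: "dist (e i) (e j) = a" if "i \<noteq> j" for i j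
  proof -
    have "(dist (e i) (e j))\<^sup>2 = a\<^sup>2"
      using that by (simp add: dist_norm power2_norm_eq_inner inner_diff ee s2)
    then show ?thesis using a by simp
  qed
  have basis: "x = 0" if "\<And>i. e i \<bullet> x = 0" for x
  proof -
    define S where "S = (\<Sum>i\<in>UNIV. x $ i)"
    have *: "s * x $ i + k * S = 0" for i
      using that[of i] by (simp add: e_def inner_add_left inner_add_right one S_def inner_axis')
    have "(\<Sum>i\<in>(UNIV::'n set). s * x $ i + k * S) = (s + n * k) * S"
      by (simp add: sum.distrib S_def n_def algebra_simps flip: sum_distrib_left)
    also have "s + n * k = h" using nk by simp
    finally have "(\<Sum>i\<in>(UNIV::'n set). s * x $ i + k * S) = h * S" .
    then have "S = 0" using h0 by (simp add: *)
    then show ?thesis using * s0 by (simp add: vec_eq_iff)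
  qed
  have eu: "2 * (e i \<bullet> u) = (norm u)\<^sup>2" for i
  proof -
    have "e i \<bullet> u = (t / sqrt n) * h"
      using nk by (simp add: u_def one e_def sum.distrib ax one_i n_def flip: sum_distrib_left)
    then show ?thesis using n by (simp add: nu h_def power2_eq_square)
  qed
  show ?thesis
    using bipyramid_axis[of f e u x y] a b eb eij basis eu nu t xy by auto
qed

section \<open>Chains of steps of equal length\<close>

text \<open>Two steps form an isosceles triangle; each further step moves the target closer to
  \<open>x\<close>. A single step would reach only the distance \<open>c\<close> itself, hence
  \<open>2 \<le> k\<close>.\<close>

lemma relpowp_dist_eq:
  fixes x y :: "'a::euclidean_space"
  assumes dim: "2 \<le> DIM('a)" and "c > 0" "2 \<le> k" "dist x y \<le> real k * c"
  shows "((\<lambda>u v. dist u v = c) ^^ k) x y"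
  using \<open>2 \<le> k\<close> \<open>dist x y \<le> real k * c\<close>
proof (induction k arbitrary: y rule: dec_induct)
  case base
  obtain z where "dist x z = c" "dist y z = c"
    using exists_triangle[OF dim, of x y c c] base \<open>c > 0\<close> by auto
  then show ?case by (auto simp: numeral_2_eq_2 dist_commute)
next
  case (step k)
  \<comment> \<open>A target within \<open>c\<close> of \<open>x\<close> is replaced by one at
    distance exactly \<open>c\<close>; a farther one is approached along the segment.\<close>
  define r where "r = (if dist x y \<le> c then c else dist x y - c)"
  have "1 * c \<le> real k * c" using step(1) \<open>c > 0\<close> by (intro mult_right_mono) auto
  then have "r \<le> real k * c" using step by (auto simp: r_def algebra_simps)
  obtain z where z: "dist x z = r" "dist y z = c"
    by (rule exists_triangle[OF dim, of x y r c])
      (use \<open>c > 0\<close> zero_le_dist[of x y] in \<open>auto simp: r_def split: if_splits simp del: zero_le_dist\<close>)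
  show ?case
    using step.IH[of z] z \<open>r \<le> real k * c\<close> by (auto simp: dist_commute)
qed

text \<open>An upper bound on the image of a step is enough here, so the estimate also covers maps
  that may collapse some steps.\<close>

lemma dist_image_relpowp_le:
  assumes "\<And>u v. dist u v = c \<Longrightarrow> dist (f u) (f v) \<le> c"
  shows "((\<lambda>u v. dist u v = c) ^^ k) x y \<Longrightarrow> dist (f x) (f y) \<le> real k * c"
proof (induction k arbitrary: y)
  case (Suc k)
  then obtain z where z: "((\<lambda>u v. dist u v = c) ^^ k) x z" "dist z y = c" by auto
  have "dist (f x) (f y) \<le> dist (f x) (f z) + dist (f z) (f y)" by (rule dist_triangle)
  also have "\<dots> \<le> real k * c + c" using Suc.IH[OF z(1)] assms[OF z(2)] by (rule add_mono)
  finally show ?case by (simp add: algebra_simps)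
qed simp

section \<open>Excluding coinciding apexes, rescaling, and a criterion for isometries\<close>

text \<open>Suppose \<open>f x = f y\<close>. If \<open>v > 1\<close>, a point \<open>z\<close> at
  distance \<open>v\<close> from \<open>x\<close> and 1 from \<open>y\<close> has an image at
  distance 1 from \<open>f x\<close>, which is neither 0 nor \<open>v\<close>. If
  \<open>v < 1\<close>, a point at distance 1 from \<open>x\<close> is reached from \<open>y\<close>
  by steps of length \<open>v\<close> with total below 1, although its image has distance 1 from
  \<open>f y\<close>.\<close>

lemma preserves_distance_if_zero_or_eq:
  fixes f :: "'a::euclidean_space \<Rightarrow> 'a"
  assumes dim: "2 \<le> DIM('a)" and one: "preserves_distance f 1" and "v > 0" "v \<noteq> 1"
    and v: "\<And>x y. dist x y = v \<Longrightarrow> f x = f y \<or> dist (f x) (f y) = v"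
  shows "preserves_distance f v"
  unfolding preserves_distance_def
proof (intro allI impI, rule ccontr)
  fix x y assume xy: "dist x y = v" and "dist (f x) (f y) \<noteq> v"
  with v have eq: "f x = f y" by blast
  show False
  proof (cases "v > 1")
    case True
    then obtain z where z: "dist x z = v" "dist y z = 1"
      using exists_triangle[OF dim, of x y v 1] xy by auto
    have "dist (f y) (f z) = 1" by (rule preserves_distanceD[OF one z(2)])
    with v[OF z(1)] eq \<open>v \<noteq> 1\<close> show False by auto
  next
    case False
    then have v1: "v < 1" using \<open>v \<noteq> 1\<close> by simp
    \<comment> \<open>The largest \<open>k\<close> with \<open>real k * v < 1\<close>; the ceiling
      minus one keeps this strict when \<open>1 / v\<close> is an integer.\<close>
    define k where "k = nat (\<lceil>1 / v\<rceil> - 1)"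
    have ge: "\<lceil>1 / v\<rceil> \<ge> 2" using v1 \<open>v > 0\<close> by (simp add: le_ceiling_iff field_simps)
    then have k: "k \<ge> 1" "real k = of_int \<lceil>1 / v\<rceil> - 1" unfolding k_def by linarith+
    have "real k < 1 / v" "1 / v \<le> real k + 1" unfolding k by linarith+
    then have kv: "real k * v < 1" "1 \<le> real k * v + v"
      using \<open>v > 0\<close> by (simp_all add: field_simps)
    moreover have "0 \<le> real k * v" using \<open>v > 0\<close> by simp
    ultimately have "v \<le> 1 + real k * v" using v1 by linarith
    then obtain z where z: "dist x z = 1" "dist y z = real k * v"
      using exists_triangle[OF dim, of x y 1 "real k * v"] xy kv by auto
    have "((\<lambda>u w. dist u w = v) ^^ k) y z"
    proof (cases "k = 1")
      case True
      show ?thesis unfolding True relpowp_1 using z True by simp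
    next
      case False then show ?thesis using relpowp_dist_eq[OF dim \<open>v > 0\<close>, of k y z] z k by simp
    qed
    moreover have "dist (f p) (f q) \<le> v" if "dist p q = v" for p q using v[OF that] \<open>v > 0\<close> by auto
    ultimately have "dist (f y) (f z) \<le> real k * v" by (rule dist_image_relpowp_le[rotated])
    moreover have "dist (f y) (f z) = 1" using preserves_distanceD[OF one z(1)] eq by simp
    ultimately show False using kv by simp
  qed
qed

text \<open>Conjugating \<open>f\<close> by the homothety of ratio \<open>d\<close> turns the
  preserved distance \<open>d\<close> into 1. The assumption ranges over all maps because it is
  applied to this conjugate.\<close>

lemma preserves_distance_scale:
  fixes f :: "'a::real_normed_vector \<Rightarrow> 'b::real_normed_vector"
  assumes c: "\<And>g :: 'a \<Rightarrow> 'b. preserves_distance g 1 \<Longrightarrow> preserves_distance g c"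
    and f: "preserves_distance f d" and "d > 0"
  shows "preserves_distance f (c * d)"
proof -
  define g where "g x = f (d *\<^sub>R x) /\<^sub>R d" for x
  have scale: "dist (r *\<^sub>R x) (r *\<^sub>R y) = r * dist x y" if "r > 0"
    for r and x y :: "'c::real_normed_vector"
    using that by (simp add: dist_norm flip: scaleR_diff_right)
  have "preserves_distance g 1"
    using f \<open>d > 0\<close> unfolding preserves_distance_def g_def by (simp add: scale)
  then have g: "preserves_distance g c" by (rule c)
  show ?thesis
    unfolding preserves_distance_def
  proof (intro allI impI)
    fix u v :: 'a assume "dist u v = c * d"
    then have "dist (u /\<^sub>R d) (v /\<^sub>R d) = c" using \<open>d > 0\<close> by (simp add: scale)
    from preserves_distanceD[OF g this] have "dist (f u) (f v) / d = c"
      using \<open>d > 0\<close> by (simp add: g_def scale divide_inverse_commute)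
    then show "dist (f u) (f v) = c * d" using \<open>d > 0\<close> by (simp add: field_simps)
  qed
qed

text \<open>For the lower bound, the segment from \<open>x\<close> to \<open>y\<close> is prolonged
  to a point \<open>z\<close> at a preserved distance from \<open>x\<close>. Since \<open>f\<close>
  does not lengthen the part from \<open>y\<close> to \<open>z\<close>, it cannot shorten the part
  from \<open>x\<close> to \<open>y\<close>.\<close>

lemma isometry_if_small_and_large_distances:
  fixes f :: "'a::euclidean_space \<Rightarrow> 'a"
  assumes dim: "2 \<le> DIM('a)"
    and small: "\<And>e. e > 0 \<Longrightarrow> \<exists>d. 0 < d \<and> d < e \<and> preserves_distance f d"
    and large: "\<And>r. \<exists>d > r. preserves_distance f d"
  shows "dist (f x) (f y) = dist x y"
proof (rule antisym)
  have nonexp: "dist (f x) (f y) \<le> dist x y" for x y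
  proof (rule field_le_epsilon)
    fix e :: real assume "e > 0"
    then obtain d where d: "0 < d" "d < e / 3" "preserves_distance f d"
      using small[of "e / 3"] by auto
    \<comment> \<open>The summand 2 ensures at least two steps; the chain is then too long by at
      most \<open>3 * d\<close>, which is below \<open>e\<close>.\<close>
    define k where "k = nat \<lceil>dist x y / d\<rceil> + 2"
    have rk: "real k = of_int \<lceil>dist x y / d\<rceil> + 2" using d by (simp add: k_def)
    then have "dist x y / d \<le> real k" "real k \<le> dist x y / d + 3" by linarith+
    then have k: "dist x y \<le> real k * d" "real k * d \<le> dist x y + 3 * d"
      using d by (simp_all add: field_simps)
    have "((\<lambda>u v. dist u v = d) ^^ k) x y"
      by (rule relpowp_dist_eq[OF dim]) (use d k in \<open>auto simp: k_def\<close>)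
    then have "dist (f x) (f y) \<le> real k * d"
      using preserves_distanceD[OF d(3)] by (intro dist_image_relpowp_le) auto
    then show "dist (f x) (f y) \<le> dist x y + e" using k d by linarith
  qed
  then show "dist (f x) (f y) \<le> dist x y" .
  obtain R where R: "R > dist x y" "preserves_distance f R" using large by blast
  then obtain z where z: "dist x z = R" "dist y z = R - dist x y"
    using exists_triangle[OF dim, of x y R "R - dist x y"] by auto
  have "R \<le> dist (f x) (f y) + dist (f y) (f z)"
    using preserves_distanceD[OF R(2) z(1)] dist_triangle by metis
  also have "dist (f y) (f z) \<le> R - dist x y" using nonexp z by metis
  finally show "dist x y \<le> dist (f x) (f y)" by simp
qed

section \<open>Particular preserved distances above and below 1\<close>

text \<open>A planar bipyramid with unequal lateral edges \<open>p\<close> and \<open>q\<close>: the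
  axis of length \<open>2 * h\<close> splits the other diagonal into the signed parts \<alpha> and
  \<beta>.\<close>

lemma planar_kite:
  fixes f :: "real ^ 'n \<Rightarrow> real ^ 'n"
  assumes dim: "CARD('n) = 2"
    and pres: "preserves_distance f p" "preserves_distance f q" "preserves_distance f (\<alpha> + \<beta>)"
    and pos: "p \<ge> 0" "q \<ge> 0" "\<alpha> + \<beta> > 0" "h > 0"
    and p: "p\<^sup>2 = h\<^sup>2 + \<alpha>\<^sup>2" and q: "q\<^sup>2 = h\<^sup>2 + \<beta>\<^sup>2" and xy: "dist x y = 2 * h"
  shows "f x = f y \<or> dist (f x) (f y) = 2 * h"
proof -
  obtain i j :: 'n where ij: "i \<noteq> j" "UNIV = {i, j}"
    using dim by (auto simp: card_2_iff)
  have k: "k = i \<or> k = j" for k using ij(2) by blast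
  define X :: "real ^ 'n" where "X = axis i 1"
  define Y :: "real ^ 'n" where "Y = axis j 1"
  have XY: "X \<bullet> X = 1" "Y \<bullet> Y = 1" "X \<bullet> Y = 0" "Y \<bullet> X = 0"
    using ij by (simp_all add: X_def Y_def inner_axis_axis)
  define b where "b k = h *\<^sub>R X + (if k = i then \<alpha> else - \<beta>) *\<^sub>R Y" for k
  define u where "u = (2 * h) *\<^sub>R X"
  have nu: "norm u = 2 * h" using pos XY by (simp add: u_def norm_eq_sqrt_inner[of X])
  have nb: "norm (b k) = (if k = i then p else q)" for k
  proof -
    have "b k \<bullet> b k = h\<^sup>2 + (if k = i then \<alpha> else - \<beta>)\<^sup>2"
      by (simp add: b_def inner_add_left inner_add_right XY power2_eq_square)
    also have "\<dots> = (if k = i then p else q)\<^sup>2" using p q by simp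
    finally show ?thesis using pos by (simp add: norm_eq_sqrt_inner)
  qed
  have db: "dist (b k) (b l) = \<alpha> + \<beta>" if "k \<noteq> l" for k l
  proof -
    have "b i - b j = (\<alpha> + \<beta>) *\<^sub>R Y" using ij by (simp add: b_def algebra_simps)
    then have "dist (b i) (b j) = \<alpha> + \<beta>" using pos XY by (simp add: dist_norm norm_eq_sqrt_inner[of Y])
    then show ?thesis using that k[of k] k[of l] by (auto simp: dist_commute)
  qed
  have basis: "z = 0" if "\<And>k. b k \<bullet> z = 0" for z
  proof -
    have "h * (X \<bullet> z) + \<alpha> * (Y \<bullet> z) = 0" "h * (X \<bullet> z) - \<beta> * (Y \<bullet> z) = 0"
      using that[of i] that[of j] ij by (simp_all add: b_def inner_add_left inner_diff_left)
    then have hX: "h * (X \<bullet> z) + \<alpha> * (Y \<bullet> z) = 0" and "(\<alpha> + \<beta>) * (Y \<bullet> z) = 0"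
      by (simp_all add: algebra_simps)
    then have Y: "Y \<bullet> z = 0" using pos by simp
    then have "X \<bullet> z = 0" using hX pos by simp
    with Y have "z $ i = 0" "z $ j = 0" by (simp_all add: X_def Y_def inner_axis')
    then have "z $ l = 0" for l using k[of l] by auto
    then show ?thesis by (simp add: vec_eq_iff)
  qed
  have bu: "2 * (b k \<bullet> u) = (norm u)\<^sup>2" for k
    unfolding nu by (simp add: b_def u_def inner_add_left inner_add_right XY power2_eq_square)
  have "u \<noteq> 0" using nu pos by auto
  then show ?thesis
    using bipyramid_axis[of f b u x y, OF _ _ basis bu] pres xy by (simp add: nb db nu)
qed

text \<open>Two regular simplices of edge 1 glued along a facet have their apexes at this distance,
  twice the height of the simplex.\<close>

lemma preserves_distance_simplex_reflection:
  fixes f :: "real ^ 'n \<Rightarrow> real ^ 'n"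
  assumes dim: "CARD('n) > 1" and f: "preserves_distance f 1"
  shows "preserves_distance f (sqrt (2 + 2 / real CARD('n)))"
proof (rule preserves_distance_if_zero_or_eq[OF _ f])
  have "1 < sqrt (2 + 2 / real CARD('n))" by (rule real_less_rsqrt) (simp add: add_pos_nonneg)
  then show "0 < sqrt (2 + 2 / real CARD('n))" "sqrt (2 + 2 / real CARD('n)) \<noteq> 1" by auto
  then show "f x = f y \<or> dist (f x) (f y) = sqrt (2 + 2 / real CARD('n))"
    if "dist x y = sqrt (2 + 2 / real CARD('n))" for x y
    using that f by (intro regular_bipyramid[of f 1 1]) (auto simp: field_simps)
qed (use dim in auto)

text \<open>In the plane \<open>2 / n = 1\<close> is no contraction. The kite with sides 1 and \<open>sqrt 3\<close> and one diagonal
  \<open>sqrt 3\<close> has the other diagonal \<open>sqrt (11 / 3)\<close>, and the rhombus with side 1 and one diagonal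
  \<open>sqrt (11 / 3)\<close> has the other diagonal \<open>1 / sqrt 3\<close>.\<close>

lemma preserves_distance_contraction_planar:
  fixes f :: "real ^ 'n \<Rightarrow> real ^ 'n"
  assumes dim: "CARD('n) = 2" and f: "preserves_distance f 1"
  shows "preserves_distance f (1 / sqrt 3)"
proof -
  have dim': "2 \<le> DIM(real ^ 'n)" using dim by simp
  have f3: "preserves_distance f (sqrt 3)"
    using preserves_distance_simplex_reflection[OF _ f] dim by simp
  have f11: "preserves_distance f (sqrt (11 / 3))"
  proof (rule preserves_distance_if_zero_or_eq[OF dim' f])
    have h: "sqrt (11 / 3) = 2 * sqrt (11 / 12)"
      by (rule real_sqrt_unique) (auto simp: power_mult_distrib)
    \<comment> \<open>The parts of the diagonal come from 1 = 11/12 + 1/12 and 3 = 11/12 + 25/12,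
      where 11/12 is the square of half the axis.\<close>
    have a: "1 / sqrt 12 + 5 / sqrt 12 = sqrt 3"
      by (rule real_sqrt_unique[symmetric]) (auto simp: power_divide simp flip: add_divide_distrib)
    show "f x = f y \<or> dist (f x) (f y) = sqrt (11 / 3)" if "dist x y = sqrt (11 / 3)" for x y
      using that unfolding h
      by (intro planar_kite[OF dim, of f 1 "sqrt 3" "1 / sqrt 12" "5 / sqrt 12"])
        (use f f3 a in \<open>auto simp: power_divide\<close>)
  qed auto
  show ?thesis
  proof (rule preserves_distance_if_zero_or_eq[OF dim' f])
    show "f x = f y \<or> dist (f x) (f y) = 1 / sqrt 3" if "dist x y = 1 / sqrt 3" for x y
      using that f f11 dim by (intro regular_bipyramid[of f "sqrt (11 / 3)" 1]) (auto simp: power_divide)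
  qed auto
qed

text \<open>The apexes of the bipyramid with facet edge \<open>sqrt (2 + 2 / n)\<close> and lateral edge 1 are
  \<open>2 / n\<close> apart.\<close>

lemma preserves_distance_contraction:
  fixes f :: "real ^ 'n \<Rightarrow> real ^ 'n"
  assumes dim: "CARD('n) > 2" and f: "preserves_distance f 1"
  shows "preserves_distance f (2 / real CARD('n))"
proof (rule preserves_distance_if_zero_or_eq[OF _ f])
  define n where "n = real CARD('n)"
  have n: "n > 2" using dim by (simp add: n_def)
  have d: "preserves_distance f (sqrt (2 + 2 / n))"
    unfolding n_def using dim by (intro preserves_distance_simplex_reflection f) auto
  have "(2 / n)\<^sup>2 = 4 * 1\<^sup>2 - 2 * (sqrt (2 + 2 / n))\<^sup>2 * (n - 1) / n"
    using n by (simp add: field_simps power2_eq_square)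
  moreover have "sqrt (2 + 2 / n) > 0" using n by (simp add: add_pos_pos)
  ultimately show "f x = f y \<or> dist (f x) (f y) = 2 / real CARD('n)"
    if "dist x y = 2 / real CARD('n)" for x y
    using that f d n unfolding n_def by (intro regular_bipyramid[of f "sqrt (2 + 2 / n)" 1]) (auto simp: n_def)
qed (use dim in auto)

section \<open>The Beckman-Quarles theorem\<close>

theorem Beckman_Quarles:
  fixes f :: "real ^ 'n \<Rightarrow> real ^ 'n"
  assumes dim: "CARD('n) > 1" and f: "preserves_distance f 1"
  shows "dist (f x) (f y) = dist x y"
proof (rule isometry_if_small_and_large_distances)
  \<comment> \<open>Preservation of \<open>c\<close> is assumed for every map \<open>g\<close>,
    since each multiplication by \<open>c\<close> uses it for another rescaling of
    \<open>f\<close>.\<close>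
  have pow: "preserves_distance f (c ^ k)"
    if "c > 0" and c: "\<And>g :: real ^ 'n \<Rightarrow> real ^ 'n. preserves_distance g 1 \<Longrightarrow> preserves_distance g c"
    for c k
  proof (induction k)
    case (Suc k)
    then show ?case using preserves_distance_scale[OF c, of f "c ^ k"] \<open>c > 0\<close> by simp
  qed (simp add: f)
  define C where "C = sqrt (2 + 2 / real CARD('n))"
  have "1 < C" unfolding C_def by (rule real_less_rsqrt) (simp add: add_pos_nonneg)
  have C: "preserves_distance f (C ^ k)" for k
    using \<open>1 < C\<close> preserves_distance_simplex_reflection[OF dim] by (intro pow) (auto simp: C_def)
  show "\<exists>d>r. preserves_distance f d" for r
    using real_arch_pow[OF \<open>1 < C\<close>, of r] C by blast
  define c where "c = (if CARD('n) = 2 then 1 / sqrt 3 else 2 / real CARD('n))"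
  have c: "0 < c" "c < 1" using dim by (auto simp: c_def)
  have "preserves_distance g c" if "preserves_distance g 1" for g :: "real ^ 'n \<Rightarrow> real ^ 'n"
    using dim preserves_distance_contraction[OF _ that] preserves_distance_contraction_planar[OF _ that]
    by (cases "CARD('n) = 2") (auto simp: c_def)
  then have pc: "preserves_distance f (c ^ k)" for k using c(1) by (rule pow[rotated])
  show "\<exists>d. 0 < d \<and> d < e \<and> preserves_distance f d" if "e > 0" for e
    using real_arch_pow_inv[OF that c(2)] pc c(1) zero_less_power by blast
qed (use dim in simp)

section \<open>Finite sets and compactness\<close>

text \<open>The vertices of a chain of unit steps from \<open>x\<close> to \<open>y\<close> form
  such a set, with the number of steps as bound. The bound is uniform in \<open>g\<close>, which
  later confines the maps to a product of balls.\<close>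

lemma finite_set_bounding_image:
  fixes x y :: "real ^ 'n"
  assumes dim: "CARD('n) > 1"
  obtains T r where "finite T" "x \<in> T" "y \<in> T"
    "\<And>g :: real ^ 'n \<Rightarrow> real ^ 'n. preserves_unit_distance_on T g \<Longrightarrow> dist (g x) (g y) \<le> r"
proof -
  have path: "\<exists>T. finite T \<and> x \<in> T \<and> y \<in> T \<and>
      (\<forall>g :: real ^ 'n \<Rightarrow> real ^ 'n. preserves_unit_distance_on T g \<longrightarrow> dist (g x) (g y) \<le> real k)"
    if "((\<lambda>u v. dist u v = 1) ^^ k) x y" for k and x y :: "real ^ 'n"
    using that
  proof (induction k arbitrary: y)
    case 0
    then show ?case by (intro exI[of _ "{x}"]) auto
  next
    case (Suc k)
    then obtain z where z: "((\<lambda>u v. dist u v = 1) ^^ k) x z" "dist z y = 1" by auto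
    from Suc.IH[OF z(1)] obtain T where T: "finite T" "x \<in> T" "z \<in> T"
      "\<And>g :: real ^ 'n \<Rightarrow> real ^ 'n. preserves_unit_distance_on T g \<Longrightarrow> dist (g x) (g z) \<le> real k" by blast
    have "dist (g x) (g y) \<le> real (Suc k)" if g: "preserves_unit_distance_on (insert y T) g"
      for g :: "real ^ 'n \<Rightarrow> real ^ 'n"
    proof -
      have "dist (g x) (g z) \<le> real k" "dist (g z) (g y) = 1"
        using g T z by (auto simp: preserves_unit_distance_on_def)
      then show ?thesis using dist_triangle[of "g x" "g y" "g z"] by simp
    qed
    then show ?case using T by (intro exI[of _ "insert y T"]) auto
  qed
  define k where "k = nat \<lceil>dist x y\<rceil> + 2"
  have "dist x y \<le> real k" unfolding k_def by linarith
  then have "((\<lambda>u v. dist u v = 1) ^^ k) x y"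
    using dim by (intro relpowp_dist_eq) (auto simp: k_def)
  from path[OF this] show ?thesis using that by blast
qed

text \<open>By Tychonoff, if every finite set carried a counterexample, then some limit of these
  counterexamples would be a map on the whole space contradicting the Beckman-Quarles theorem.\<close>

lemma eps_set_exists:
  fixes x y :: "real ^ 'n"
  assumes dim: "CARD('n) > 1" and "\<epsilon> > 0"
  shows "\<exists>T. eps_set \<epsilon> x y T"
proof (rule ccontr)
  assume none: "\<nexists>T. eps_set \<epsilon> x y T"
  have "\<forall>p. \<exists>T r. finite T \<and> x \<in> T \<and> p \<in> T \<and>
      (\<forall>g :: real ^ 'n \<Rightarrow> real ^ 'n. preserves_unit_distance_on T g \<longrightarrow> dist (g x) (g p) \<le> r)"
    using finite_set_bounding_image[OF dim, of x] by metis
  then obtain P r where P: "\<And>p. finite (P p)" "\<And>p. x \<in> P p" "\<And>p. p \<in> P p"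
    and r: "\<And>p (g :: real ^ 'n \<Rightarrow> real ^ 'n).
      preserves_unit_distance_on (P p) g \<Longrightarrow> dist (g x) (g p) \<le> r p"
    by metis
  \<comment> \<open>The absolute value puts 0 into every ball, as the default value of
    \<open>g'\<close> below requires.\<close>
  define K :: "(real ^ 'n \<Rightarrow> real ^ 'n) set" where "K = PiE UNIV (\<lambda>p. cball 0 \<bar>r p\<bar>)"
  \<comment> \<open>The weak inequality makes \<open>F T\<close> closed, and it still contradicts an
    isometry because \<epsilon> is positive.\<close>
  define F :: "(real ^ 'n) set \<Rightarrow> (real ^ 'n \<Rightarrow> real ^ 'n) set" where
    "F T = {g. preserves_unit_distance_on T g \<and> \<epsilon> \<le> \<bar>dist (g x) (g y) - dist x y\<bar>}" for T
  have "compactin (product_topology (\<lambda>_. euclidean) UNIV) K"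
    unfolding K_def by (subst compactin_PiE) simp
  then have compact: "compact K" by (simp add: euclidean_product_topology)
  have closed: "closed (F T)" for T
  proof -
    have "closed {g :: real ^ 'n \<Rightarrow> real ^ 'n. dist (g u) (g v) = 1}" for u v
      by (intro closed_Collect_eq continuous_intros continuous_on_product_coordinates)
    moreover have "closed {g :: real ^ 'n \<Rightarrow> real ^ 'n. \<epsilon> \<le> \<bar>dist (g x) (g y) - dist x y\<bar>}"
      by (intro closed_Collect_le continuous_intros continuous_on_product_coordinates)
    moreover have "F T = (\<Inter>u\<in>T. \<Inter>v\<in>{v\<in>T. dist u v = 1}. {g. dist (g u) (g v) = 1}) \<inter>
        {g. \<epsilon> \<le> \<bar>dist (g x) (g y) - dist x y\<bar>}"
      by (auto simp: F_def preserves_unit_distance_on_def)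
    ultimately show ?thesis by (simp add: closed_Int closed_INT)
  qed
  have fip: "K \<inter> (\<Inter>T\<in>\<T>. F T) \<noteq> {}" if "finite \<T>" "\<T> \<subseteq> Collect finite" for \<T>
  proof -
    \<comment> \<open>\<open>S\<close> gathers all points that the finitely many conditions mention.
      \<open>S'\<close> adds the chains to them, so a counterexample on \<open>S'\<close> is bounded
      at each point of \<open>S\<close>.\<close>
    define S where "S = insert x (insert y (\<Union>\<T>))"
    define S' where "S' = (\<Union>p\<in>S. P p)"
    have S: "finite S" "x \<in> S" "y \<in> S" using that by (auto simp: S_def)
    have S': "finite S'" "S \<subseteq> S'" using S(1) P(1,3) by (auto simp: S'_def)
    have "x \<in> S'" "y \<in> S'" using S S' by blast+
    moreover have "\<not> eps_set \<epsilon> x y S'" using none by blast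
    ultimately obtain g where
      g: "preserves_unit_distance_on S' g" "\<epsilon> < \<bar>dist (g x) (g y) - dist x y\<bar>"
      using S'(1) unfolding eps_set_def not_le[symmetric] by blast
    \<comment> \<open>The translation moves the image of \<open>x\<close> to 0, the centre of the
      balls, without changing distances within \<open>S\<close>.\<close>
    define g' where "g' p = (if p \<in> S then g p - g x else 0)" for p
    have g'_dist: "dist (g' u) (g' v) = dist (g u) (g v)" if "u \<in> S" "v \<in> S" for u v
      using that by (simp add: g'_def dist_norm)
    have "norm (g' p) \<le> \<bar>r p\<bar>" for p
    proof (cases "p \<in> S")
      case True
      then have "preserves_unit_distance_on (P p) g"
        using g(1) by (auto simp: preserves_unit_distance_on_def S'_def)
      from r[OF this] show ?thesis using True by (simp add: g'_def dist_norm norm_minus_commute)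
    qed (simp add: g'_def)
    then have "g' \<in> K" by (simp add: K_def PiE_iff)
    moreover have "g' \<in> F T" if "T \<in> \<T>" for T
    proof -
      have "T \<subseteq> S" using that by (auto simp: S_def)
      then show ?thesis
        using g S S' by (auto simp: F_def preserves_unit_distance_on_def g'_dist subset_iff)
    qed
    ultimately show ?thesis by blast
  qed
  have "K \<inter> (\<Inter>T\<in>Collect finite. F T) \<noteq> {}"
    by (rule compact_imp_fip_image[OF compact closed fip])
  then obtain g where g: "\<And>T. finite T \<Longrightarrow> g \<in> F T" by auto
  have "preserves_distance g 1"
    unfolding preserves_distance_def
  proof (intro allI impI)
    fix u v :: "real ^ 'n" assume "dist u v = 1"
    then show "dist (g u) (g v) = 1"
      using g[of "{u, v}"] by (auto simp: F_def preserves_unit_distance_on_def)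
  qed
  then have "dist (g x) (g y) = dist x y" by (rule Beckman_Quarles[OF dim])
  \<comment> \<open>For the empty set only the deviation condition of \<open>F\<close>
    remains.\<close>
  moreover have "\<epsilon> \<le> \<bar>dist (g x) (g y) - dist x y\<bar>" using g[of "{}"] by (simp add: F_def)
  ultimately show False using \<open>\<epsilon> > 0\<close> by simp
qed

section \<open>Comparison of the two image distances\<close>

theorem corollary2:
  fixes J K L M :: "real ^ 'n" and \<epsilon> :: real
  assumes "CARD('n) > 1"
    and "dist J K < dist L M"
    and "\<epsilon> = (dist L M - dist J K) / 3"
  shows "(\<exists>T\<^sub>J\<^sub>K. eps_set \<epsilon> J K T\<^sub>J\<^sub>K) \<and> (\<exists>T\<^sub>L\<^sub>M. eps_set \<epsilon> L M T\<^sub>L\<^sub>M) \<and>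
    (\<forall>T\<^sub>J\<^sub>K T\<^sub>L\<^sub>M. eps_set \<epsilon> J K T\<^sub>J\<^sub>K \<longrightarrow> eps_set \<epsilon> L M T\<^sub>L\<^sub>M \<longrightarrow>
      (\<forall>f. preserves_unit_distance_on (T\<^sub>J\<^sub>K \<union> T\<^sub>L\<^sub>M) f \<longrightarrow> dist (f J) (f K) < dist (f L) (f M)))"
proof (intro conjI allI impI)
  have "\<epsilon> > 0" using assms by simp
  then show "\<exists>T. eps_set \<epsilon> J K T" "\<exists>T. eps_set \<epsilon> L M T"
    using assms(1) by (auto intro: eps_set_exists)
  fix T T' f
  assume TT': "eps_set \<epsilon> J K T" "eps_set \<epsilon> L M T'" and f: "preserves_unit_distance_on (T \<union> T') f"
  have "preserves_unit_distance_on T f" "preserves_unit_distance_on T' f"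
    using f by (auto simp: preserves_unit_distance_on_def)
  with TT' have "\<bar>dist (f J) (f K) - dist J K\<bar> \<le> \<epsilon>" "\<bar>dist (f L) (f M) - dist L M\<bar> \<le> \<epsilon>"
    by (auto simp: eps_set_def)
  \<comment> \<open>The gap is three times \<epsilon> and each distance changes by at most
    \<epsilon>, so a gap of at least \<epsilon> remains.\<close>
  moreover have "dist L M - dist J K = 3 * \<epsilon>" using assms by simp
  ultimately show "dist (f J) (f K) < dist (f L) (f M)" using \<open>\<epsilon> > 0\<close> by linarith
qed

end
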